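(* Let $U:=\langle s_{01},s_{02},s_{23}\rangle\le\Lambda$. The stabilizer of $U$ in $\mathrm{GL}_4(\mathbb K)$ is $$\mathrm{GL}_4(\mathbb K)_U=\left\{\begin{pmatrix} a & b & 0 & c \\ 0 & d & 0 & 0 \\ 0 & e & f & g \\ 0 & 0 & 0 & h \end{pmatrix}\ \middle|\ \begin{matrix} a,d,f,h\in\mathbb K^\times \\ b,c,e,g\in\mathbb K \end{matrix}\right\}\cup\left\{\begin{pmatrix} 0 & c & a & b \\ 0 & 0 & 0 & d \\ f & g & 0 & e \\ 0 & h & 0 & 0 \end{pmatrix}\ \middle|\ \begin{matrix} a,d,f,h\in\mathbb K^\times \\ b,c,e,g\in\mathbb K \end{matrix}\right\}.$$ This group has $5$ orbits on $\mathbb K^4$, represented by $0$, $b_0$, $b_0+b_2$, $b_0+b_2+b_3$, $b_1+b_3$, and $4$ orbits on $\Lambda/U$, represented by $U$, $s_{03}+U$, $s_{13}+U$, $s_{03}+s_{12}+U$.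
   Context: $\mathbb K$ is an arbitrary field; $X'$ denotes the transpose of a matrix $X$; $b_0,b_1,b_2,b_3$ is the standard basis of $\mathbb K^4$ (column vectors). $\Lambda=\mathbb K^4\wedge\mathbb K^4$ is the space of skew-symmetric $4\times4$ matrices over $\mathbb K$ with zero diagonal, and $s_{jk}:=b_jb_k'-b_kb_j'$ for $0\le j<k\le3$. The group $\mathrm{GL}_4(\mathbb K)$ acts on $\mathbb K^4$ naturally and on $\Lambda$ by $M.X:=MXM'$. For $U\le\Lambda$, $\mathrm{GL}_4(\mathbb K)_U$ is the stabilizer of $U$ under this action; it acts on $\Lambda/U$. $\langle\cdots\rangle$ denotes $\mathbb K$-span. (The space $U$ is denoted $E+S$ in the paper.) "The orbits are represented by" a list means that each orbit contains exactly one member of the list. *)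

theory Defs
  imports "HOL-Analysis.Analysis" "HOL-Algebra.Group_Action"
begin

text \<open>
  Matrices are those of HOL-Analysis, indexed here by the type \<^typ>\<open>4\<close>. Its elements are
  \<open>0, 1, 2, 3\<close> (and \<open>4 = 0\<close>), so that rows and columns are numbered from \<open>0\<close>.
  The library function \<^const>\<open>vector\<close> is not used, because it numbers the entries
  from \<open>1\<close> and would put the fourth one at index \<open>0\<close>.
\<close>

definition vec4 :: "'b \<Rightarrow> 'b \<Rightarrow> 'b \<Rightarrow> 'b \<Rightarrow> 'b ^ 4" where
  "vec4 x\<^sub>0 x\<^sub>1 x\<^sub>2 x\<^sub>3 =
    (\<chi> i. if i = 0 then x\<^sub>0 else if i = 1 then x\<^sub>1 else if i = 2 then x\<^sub>2 else x\<^sub>3)"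

text \<open>A matrix is the vector of its rows, so nested \<^const>\<open>vec4\<close> lists a matrix row by row.\<close>

abbreviation mat4 :: "'b ^ 4 \<Rightarrow> 'b ^ 4 \<Rightarrow> 'b ^ 4 \<Rightarrow> 'b ^ 4 \<Rightarrow> 'b ^ 4 ^ 4" where
  "mat4 \<equiv> vec4"

lemma vec4_nth [simp]:
  "vec4 x\<^sub>0 x\<^sub>1 x\<^sub>2 x\<^sub>3 $ 0 = x\<^sub>0" "vec4 x\<^sub>0 x\<^sub>1 x\<^sub>2 x\<^sub>3 $ 1 = x\<^sub>1"
  "vec4 x\<^sub>0 x\<^sub>1 x\<^sub>2 x\<^sub>3 $ 2 = x\<^sub>2" "vec4 x\<^sub>0 x\<^sub>1 x\<^sub>2 x\<^sub>3 $ 3 = x\<^sub>3"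
  by (simp_all add: vec4_def)

definition bvec :: "4 \<Rightarrow> 'a::field ^ 4" where
  "bvec j = axis j 1"

definition s :: "4 \<Rightarrow> 4 \<Rightarrow> 'a::field ^ 4 ^ 4" where
  "s j k =
    (columnvector (bvec j) :: 'a ^ 1 ^ 4) ** (rowvector (bvec k) :: 'a ^ 4 ^ 1)
    - (columnvector (bvec k) :: 'a ^ 1 ^ 4) ** (rowvector (bvec j) :: 'a ^ 4 ^ 1)"

definition Lam :: "('a::field ^ 4 ^ 4) set"  (\<open>\<Lambda>\<close>) where
  "\<Lambda> = {X. transpose X = - X \<and> (\<forall>i. X $ i $ i = 0)}"

text \<open>
  \<^const>\<open>scaleR\<close> is available over the reals only and \<open>(*s)\<close> scales vectors only, so the
  vector space structure of the matrices over an arbitrary field is supplied here.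
\<close>

definition mscale :: "'a::field \<Rightarrow> 'a ^ 'n ^ 'm \<Rightarrow> 'a ^ 'n ^ 'm" where
  "mscale c X = (\<chi> i j. c * X $ i $ j)"

global_interpretation matspace: vector_space "mscale :: 'a::field \<Rightarrow> 'a ^ 'n ^ 'm \<Rightarrow> 'a ^ 'n ^ 'm"
  by standard (simp_all add: mscale_def vec_eq_iff algebra_simps)

definition GL4 :: "('a::field ^ 4 ^ 4) monoid" where
  "GL4 = \<lparr>carrier = {M. invertible M}, mult = (**), one = mat 1\<rparr>"

definition mact :: "'a::field ^ 4 ^ 4 \<Rightarrow> 'a ^ 4 ^ 4 \<Rightarrow> 'a ^ 4 ^ 4" where
  "mact M X = M ** X ** transpose M"

text \<open>
  The induced action on sets of matrices. On a subspace \<open>U\<close> it gives \<open>M.U\<close>, and on a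
  coset it gives \<open>M.(X + U) = M.X + M.U\<close>, which is \<open>M.X + U\<close> for \<open>M\<close> in the stabilizer of \<open>U\<close>.
\<close>

definition mact_set :: "'a::field ^ 4 ^ 4 \<Rightarrow> ('a ^ 4 ^ 4) set \<Rightarrow> ('a ^ 4 ^ 4) set" where
  "mact_set M V = mact M ` V"

definition GL4_stab :: "('a::field ^ 4 ^ 4) set \<Rightarrow> ('a ^ 4 ^ 4) monoid" where
  "GL4_stab U = GL4\<lparr>carrier := stabilizer GL4 mact_set U\<rparr>"

definition Lam_quot :: "('a::field ^ 4 ^ 4) set \<Rightarrow> ('a ^ 4 ^ 4) set set" where
  "Lam_quot U = {X +o U | X. X \<in> \<Lambda>}"

definition orbits_represented_by ::
    "('g, 'm) monoid_scheme \<Rightarrow> 'x set \<Rightarrow> ('g \<Rightarrow> 'x \<Rightarrow> 'x) \<Rightarrow> 'x set \<Rightarrow> bool" where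
  "orbits_represented_by G E \<phi> R \<longleftrightarrow>
    R \<subseteq> E \<and> (\<forall>Om \<in> orbits G E \<phi>. \<exists>!r. r \<in> R \<and> r \<in> Om)"

lemma group_GL4: "group (GL4 :: ('a::field ^ 4 ^ 4) monoid)"
proof (rule groupI)
  fix M :: "'a ^ 4 ^ 4"
  assume "M \<in> carrier GL4"
  then show "\<exists>N \<in> carrier GL4. N \<otimes>\<^bsub>GL4\<^esub> M = \<one>\<^bsub>GL4\<^esub>"
    by (auto simp: GL4_def invertible_def)
qed (auto simp: GL4_def invertible_mult matrix_mul_assoc invertible_def[of "mat 1"])

lemma mact_mult: "mact (M ** N) X = mact M (mact N X)"
  by (simp add: mact_def matrix_transpose_mul matrix_mul_assoc)

lemma mact_one [simp]: "mact (mat 1) X = X"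
  by (simp add: mact_def)

lemma group_GL4_stab: "group (GL4_stab U)"
proof -
  have "subgroup (stabilizer GL4 mact_set U) GL4"
  proof
    show "x \<otimes>\<^bsub>GL4\<^esub> y \<in> stabilizer GL4 mact_set U"
      if "x \<in> stabilizer GL4 mact_set U" "y \<in> stabilizer GL4 mact_set U" for x y
    proof -
      have "mact (x ** y) ` U = mact x ` (mact y ` U)"
        by (simp add: image_image mact_mult)
      with that show ?thesis
        by (simp add: stabilizer_def mact_set_def GL4_def invertible_mult)
    qed
    show "inv\<^bsub>GL4\<^esub> x \<in> stabilizer GL4 mact_set U"
      if x: "x \<in> stabilizer GL4 mact_set U" for x
    proof -
      interpret group "GL4 :: ('a ^ 4 ^ 4) monoid" by (rule group_GL4)
      have c: "x \<in> carrier GL4" and U: "mact x ` U = U"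
        using x by (auto simp: stabilizer_def mact_set_def)
      have "inv\<^bsub>GL4\<^esub> x ** x = mat 1"
        using l_inv[OF c] by (simp add: GL4_def)
      then have "mact (inv\<^bsub>GL4\<^esub> x) ` (mact x ` U) = U"
        by (simp add: image_image flip: mact_mult)
      with U inv_closed[OF c] show ?thesis
        by (simp add: stabilizer_def mact_set_def)
    qed
  qed (auto simp: stabilizer_def mact_set_def GL4_def invertible_def[of "mat 1"])
  then show ?thesis
    unfolding GL4_stab_def by (rule group.subgroup_imp_group[OF group_GL4])
qed

end

theory Submission
  imports Defs
begin

text \<open>
  If \<open>u\<close> lies outside \<open>\<langle>b\<^sub>0, b\<^sub>2\<rangle>\<close>, then \<open>u \<and> v \<in> U\<close> forces \<open>v \<in> \<langle>u, b\<^sub>n\<rangle>\<close> for an \<open>n\<close> depending only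
  on \<open>u\<close>. The columns of a stabilizing matrix satisfy \<open>m\<^sub>0 \<and> m\<^sub>1, m\<^sub>0 \<and> m\<^sub>2, m\<^sub>2 \<and> m\<^sub>3 \<in> U\<close>, so their
  independence gives \<open>m\<^sub>0, m\<^sub>2 \<in> \<langle>b\<^sub>0, b\<^sub>2\<rangle>\<close>, and the remaining equations leave the two shapes of
  matrices. The coset of \<open>X \<in> \<Lambda>\<close> is determined by the entries at \<open>(0,3)\<close>, \<open>(1,2)\<close> and \<open>(1,3)\<close>, on
  which the two shapes act by explicit formulas.
\<close>

section \<open>Coordinates on \<open>\<Lambda>\<close> and on the span of the three
  generators\<close>

lemma UNIV_four: "(UNIV :: 4 set) = {0, 1, 2, 3}"
  unfolding UNIV_4 by auto

lemma sum_four: "sum f (UNIV :: 4 set) = f 0 + f 1 + f 2 + f 3"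
  unfolding UNIV_four by (simp add: add.assoc)

lemma all_four: "(\<forall>i :: 4. P i) \<longleftrightarrow> P 0 \<and> P 1 \<and> P 2 \<and> P 3"
proof -
  have "(\<forall>i. P i) \<longleftrightarrow> (\<forall>i\<in>UNIV. P i)"
    by simp
  then show ?thesis
    unfolding UNIV_four by simp
qed

lemma bvec_nth: "bvec j $ i = of_bool (i = j)"
  by (simp add: bvec_def axis_def)

lemma s_nth: "s j k $ l $ m = of_bool (l = j \<and> m = k) - of_bool (l = k \<and> m = j)"
  by (simp add: s_def matrix_matrix_mult_def columnvector_def rowvector_def bvec_nth of_bool_conj)

lemma mact_nth: "mact M X $ i $ j = (\<Sum>k\<in>UNIV. (\<Sum>l\<in>UNIV. M $ i $ l * X $ l $ k) * M $ j $ k)"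
  by (simp add: mact_def matrix_matrix_mult_def transpose_def)

lemma mact_diff: "mact M (X - Y) = mact M X - mact M Y"
  by (simp add: vec_eq_iff mact_nth sum_subtractf algebra_simps)

lemma mem_Lam_iff:
  "X \<in> \<Lambda> \<longleftrightarrow>
    X $ 0 $ 0 = 0 \<and> X $ 1 $ 1 = 0 \<and> X $ 2 $ 2 = 0 \<and> X $ 3 $ 3 = 0 \<and>
    X $ 1 $ 0 = - X $ 0 $ 1 \<and> X $ 2 $ 0 = - X $ 0 $ 2 \<and> X $ 3 $ 0 = - X $ 0 $ 3 \<and>
    X $ 2 $ 1 = - X $ 1 $ 2 \<and> X $ 3 $ 1 = - X $ 1 $ 3 \<and> X $ 3 $ 2 = - X $ 2 $ 3"
  by (auto simp: Lam_def vec_eq_iff transpose_def all_four)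

lemma Lam_diff: "X \<in> \<Lambda> \<Longrightarrow> Y \<in> \<Lambda> \<Longrightarrow> X - Y \<in> \<Lambda>"
  by (simp add: mem_Lam_iff)

lemma mact_Lam:
  assumes "X \<in> \<Lambda>"
  shows "mact M X \<in> \<Lambda>"
proof -
  have X: "transpose X = - X"
    using assms by (simp add: Lam_def)
  have neg: "M ** (- X) = - (M ** X)" "(- (M ** X)) ** transpose M = - (M ** X ** transpose M)"
    by (simp_all add: vec_eq_iff matrix_matrix_mult_def sum_negf)
  have "transpose (mact M X) = - mact M X"
    by (simp add: mact_def matrix_transpose_mul X matrix_mul_assoc neg)
  \<comment> \<open>In characteristic 2 skew symmetry does not force a zero diagonal. The entry is a
    quadratic form in row \<open>i\<close> of \<open>M\<close>: its terms at \<open>(l, k)\<close>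
    and \<open>(k, l)\<close> cancel, and those at \<open>(k, k)\<close> vanish.\<close>
  moreover have "mact M X $ i $ i = 0" for i
  proof -
    have "mact M X $ i $ i =
      (\<Sum>k\<in>UNIV. \<Sum>l\<in>UNIV. M $ i $ l * X $ l $ k * M $ i $ k)"
      by (simp add: mact_nth sum_distrib_right)
    also have "\<dots> = 0"
      using assms[unfolded mem_Lam_iff] by (simp add: sum_four mult_ac)
    finally show ?thesis .
  qed
  ultimately show ?thesis
    by (simp add: Lam_def)
qed

text \<open>The six matrices \<open>s j k\<close> with j < k form a basis of
  \<open>\<Lambda>\<close>, and the entry of \<open>X\<close> at \<open>(j, k)\<close> is its
  coordinate at \<open>s j k\<close>. The three conditions kill the coordinates at the basis
  elements outside the span.\<close>

lemma mem_span_iff: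
  "X \<in> matspace.span {s 0 1, s 0 2, s 2 3} \<longleftrightarrow>
    X \<in> \<Lambda> \<and> X $ 0 $ 3 = 0 \<and> X $ 1 $ 2 = 0 \<and> X $ 1 $ 3 = 0"
proof
  assume "X \<in> matspace.span {s 0 1, s 0 2, s 2 3}"
  then obtain p q r where "X - mscale p (s 0 1) - mscale q (s 0 2) - mscale r (s 2 3) = 0"
    unfolding matspace.span_breakdown_eq matspace.span_empty by auto
  then have "X = mscale p (s 0 1) + mscale q (s 0 2) + mscale r (s 2 3)"
    by (simp add: algebra_simps)
  then show "X \<in> \<Lambda> \<and> X $ 0 $ 3 = 0 \<and> X $ 1 $ 2 = 0 \<and> X $ 1 $ 3 = 0"
    by (simp add: mem_Lam_iff s_nth mscale_def)
next
  assume "X \<in> \<Lambda> \<and> X $ 0 $ 3 = 0 \<and> X $ 1 $ 2 = 0 \<and> X $ 1 $ 3 = 0"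
  then have "X = mscale (X $ 0 $ 1) (s 0 1) + mscale (X $ 0 $ 2) (s 0 2) + mscale (X $ 2 $ 3) (s 2 3)"
    by (simp add: vec_eq_iff all_four mem_Lam_iff s_nth mscale_def)
  moreover have "\<dots> \<in> matspace.span {s 0 1, s 0 2, s 2 3}"
    by (intro matspace.span_add matspace.span_scale matspace.span_base) auto
  ultimately show "X \<in> matspace.span {s 0 1, s 0 2, s 2 3}"
    by metis
qed

section \<open>The two families of matrices and their action on \<open>\<Lambda>\<close>\<close>

definition tri_mat :: "'a \<Rightarrow> 'a \<Rightarrow> 'a \<Rightarrow> 'a \<Rightarrow> 'a \<Rightarrow> 'a \<Rightarrow> 'a \<Rightarrow> 'a \<Rightarrow> 'a::field ^ 4 ^ 4" where
  "tri_mat a b c d e f g h =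
    mat4 (vec4 a b 0 c) (vec4 0 d 0 0) (vec4 0 e f g) (vec4 0 0 0 h)"

text \<open>This is \<open>tri_mat a b c d e f g h\<close> times the permutation matrix of (0 2)(1
  3) on the right. The permutation exchanges \<open>s 0 1\<close> and \<open>s 2 3\<close> and
  negates \<open>s 0 2\<close>, so it preserves their span.\<close>

definition swap_mat :: "'a \<Rightarrow> 'a \<Rightarrow> 'a \<Rightarrow> 'a \<Rightarrow> 'a \<Rightarrow> 'a \<Rightarrow> 'a \<Rightarrow> 'a \<Rightarrow> 'a::field ^ 4 ^ 4" where
  "swap_mat a b c d e f g h =
    mat4 (vec4 0 c a b) (vec4 0 0 0 d) (vec4 f g 0 e) (vec4 0 h 0 0)"

definition stab_mats :: "('a::field ^ 4 ^ 4) set" where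
  "stab_mats =
    {tri_mat a b c d e f g h | a b c d e f g h. a \<noteq> 0 \<and> d \<noteq> 0 \<and> f \<noteq> 0 \<and> h \<noteq> 0} \<union>
    {swap_mat a b c d e f g h | a b c d e f g h. a \<noteq> 0 \<and> d \<noteq> 0 \<and> f \<noteq> 0 \<and> h \<noteq> 0}"

lemma tri_mat_in: "a \<noteq> 0 \<Longrightarrow> d \<noteq> 0 \<Longrightarrow> f \<noteq> 0 \<Longrightarrow> h \<noteq> 0 \<Longrightarrow> tri_mat a b c d e f g h \<in> stab_mats"
  unfolding stab_mats_def by blast

lemma swap_mat_in: "a \<noteq> 0 \<Longrightarrow> d \<noteq> 0 \<Longrightarrow> f \<noteq> 0 \<Longrightarrow> h \<noteq> 0 \<Longrightarrow> swap_mat a b c d e f g h \<in> stab_mats"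
  unfolding stab_mats_def by blast

lemma stab_mats_cases [consumes 1, case_names tri swap]:
  assumes "M \<in> stab_mats"
  obtains a b c d e f g h where
      "M = tri_mat a b c d e f g h" "a \<noteq> 0" "d \<noteq> 0" "f \<noteq> 0" "h \<noteq> 0"
    | a b c d e f g h where
      "M = swap_mat a b c d e f g h" "a \<noteq> 0" "d \<noteq> 0" "f \<noteq> 0" "h \<noteq> 0"
  using assms unfolding stab_mats_def by blast

lemma stab_mats_inverse:
  assumes "M \<in> stab_mats"
  obtains N where "N \<in> stab_mats" "M ** N = mat 1" "N ** M = mat 1"
  using assms
proof (cases rule: stab_mats_cases)
  case (tri a b c d e f g h)
  \<comment> \<open>Back substitution: coordinates 1 and 3 are only scaled by \<open>d\<close> and
    \<open>h\<close>, after which the equations for coordinates 0 and 2 can be solved.\<close>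
  let ?N = "tri_mat (1/a) (-b/(a*d)) (-c/(a*h)) (1/d) (-e/(f*d)) (1/f) (-g/(f*h)) (1/h)"
  show ?thesis
  proof (rule that)
    show "?N \<in> stab_mats" using tri by (simp add: tri_mat_in)
    show "M ** ?N = mat 1" "?N ** M = mat 1"
      using tri by (simp_all add: vec_eq_iff all_four matrix_matrix_mult_def sum_four tri_mat_def
          mat_def field_simps)
  qed
next
  case (swap a b c d e f g h)
  \<comment> \<open>If \<open>M\<close> is T P with T in the first family and P the permutation (0
    2)(1 3), its inverse is (P T^-1 P) P. Conjugation by P exchanges the indices 0 with 2 and 1 with
    3 in the inverse of T, which gives these parameters.\<close>
  let ?N = "swap_mat (1/f) (-g/(f*h)) (-e/(f*d)) (1/h) (-c/(a*h)) (1/a) (-b/(a*d)) (1/d)"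
  show ?thesis
  proof (rule that)
    show "?N \<in> stab_mats" using swap by (simp add: swap_mat_in)
    show "M ** ?N = mat 1" "?N ** M = mat 1"
      using swap by (simp_all add: vec_eq_iff all_four matrix_matrix_mult_def sum_four swap_mat_def
          mat_def field_simps)
  qed
qed

text \<open>The three entries that vanish on the span transform among themselves. Hence these
  formulas give both the invariance of the span and the action on the quotient in
  coordinates.\<close>

lemma mact_tri_mat:
  assumes "X \<in> \<Lambda>"
  shows "mact (tri_mat a b c d e f g h) X $ 0 $ 3 = a * h * X $ 0 $ 3 + b * h * X $ 1 $ 3"
    and "mact (tri_mat a b c d e f g h) X $ 1 $ 2 = d * f * X $ 1 $ 2 + d * g * X $ 1 $ 3"
    and "mact (tri_mat a b c d e f g h) X $ 1 $ 3 = d * h * X $ 1 $ 3"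
  using assms by (simp_all add: mem_Lam_iff mact_nth sum_four tri_mat_def algebra_simps)

lemma mact_swap_mat:
  assumes "X \<in> \<Lambda>"
  shows "mact (swap_mat a b c d e f g h) X $ 0 $ 3 = - (a * h * X $ 1 $ 2) - b * h * X $ 1 $ 3"
    and "mact (swap_mat a b c d e f g h) X $ 1 $ 2 = - (d * f * X $ 0 $ 3) - d * g * X $ 1 $ 3"
    and "mact (swap_mat a b c d e f g h) X $ 1 $ 3 = - (d * h * X $ 1 $ 3)"
  using assms by (simp_all add: mem_Lam_iff mact_nth sum_four swap_mat_def algebra_simps)

text \<open>The coordinate formulas give only the inclusion in \<open>U\<close>. Equality follows
  because the inverse of \<open>M\<close> lies in \<open>stab_mats\<close> too and satisfies the
  same inclusion.\<close>

lemma stab_mats_stabilize: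
  assumes "M \<in> stab_mats" and U: "U = matspace.span {s 0 1, s 0 2, s 2 3}"
  shows "mact M ` U = U"
proof -
  have sub: "mact N ` U \<subseteq> U" if "N \<in> stab_mats" for N
    using that
    by (cases rule: stab_mats_cases)
      (auto simp: U mem_span_iff mact_Lam mact_tri_mat mact_swap_mat)
  obtain N where N: "N \<in> stab_mats" "M ** N = mat 1"
    using stab_mats_inverse[OF assms(1)] .
  have "U = mact M ` mact N ` U"
    using N by (simp add: image_image flip: mact_mult)
  with sub[OF N(1)] sub[OF assms(1)] show ?thesis
    by blast
qed

section \<open>Independence of columns and rows, and a criterion for orbit representatives\<close>

lemma invertible_kernel:
  fixes M :: "'a::field ^ 'n ^ 'n"
  assumes "invertible M" "M *v x = 0"
  shows "x = 0"
  using assms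
  by (metis invertible_def matrix_vector_mul_assoc matrix_vector_mul_lid matrix_vector_mult_0_right)

lemma invertible_columns:
  fixes M :: "'a::field ^ 4 ^ 4"
  assumes "invertible M"
    and "\<And>i. M $ i $ 0 * x0 + M $ i $ 1 * x1 + M $ i $ 2 * x2 + M $ i $ 3 * x3 = 0"
  shows "x0 = 0 \<and> x1 = 0 \<and> x2 = 0 \<and> x3 = 0"
proof -
  have "M *v vec4 x0 x1 x2 x3 = 0"
    using assms(2) by (simp add: vec_eq_iff matrix_vector_mult_def sum_four)
  then have "vec4 x0 x1 x2 x3 = 0"
    by (rule invertible_kernel[OF assms(1)])
  then show ?thesis
    by (simp add: vec_eq_iff all_four)
qed

lemma invertible_rows:
  fixes M :: "'a::field ^ 4 ^ 4"
  assumes "invertible M"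
    and "\<And>i. M $ 0 $ i * x0 + M $ 1 $ i * x1 + M $ 2 $ i * x2 + M $ 3 $ i * x3 = 0"
  shows "x0 = 0 \<and> x1 = 0 \<and> x2 = 0 \<and> x3 = 0"
proof (rule invertible_columns)
  show "invertible (transpose M)"
    using assms(1) unfolding invertible_def by (metis matrix_transpose_mul transpose_mat)
  show "transpose M $ i $ 0 * x0 + transpose M $ i $ 1 * x1 + transpose M $ i $ 2 * x2
      + transpose M $ i $ 3 * x3 = 0" for i
    using assms(2) by (simp add: transpose_def)
qed

text \<open>Moving a point by a group element does not change its orbit. So \<open>cover\<close>
  makes \<open>orbit G \<phi>\<close> a map from \<open>R\<close> onto the set of orbits, and
  \<open>sep\<close> makes it injective; this gives the number of orbits as well as the unique
  representatives.\<close>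

lemma orbits_represented_by_transversal:
  assumes "group G" and fin: "finite R" and "R \<subseteq> E"
    and one: "\<And>x. \<phi> \<one>\<^bsub>G\<^esub> x = x"
    and mult: "\<And>g h x. g \<in> carrier G \<Longrightarrow> h \<in> carrier G \<Longrightarrow> \<phi> (g \<otimes>\<^bsub>G\<^esub> h) x = \<phi> g (\<phi> h x)"
    and cover: "\<And>x. x \<in> E \<Longrightarrow> \<exists>r \<in> R. \<exists>g \<in> carrier G. \<phi> g r = x"
    and sep: "\<And>r g. r \<in> R \<Longrightarrow> g \<in> carrier G \<Longrightarrow> \<phi> g r \<in> R \<Longrightarrow> \<phi> g r = r"
  shows "card (orbits G E \<phi>) = card R \<and> orbits_represented_by G E \<phi> R"
proof -
  interpret group G by fact
  have orbit_sub: "orbit G \<phi> (\<phi> g x) \<subseteq> orbit G \<phi> x" if "g \<in> carrier G" for g x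
    using that m_closed unfolding orbit_def by (fastforce simp flip: mult)
  have orbit_eq: "orbit G \<phi> (\<phi> g x) = orbit G \<phi> x" if g: "g \<in> carrier G" for g x
  proof
    have "\<phi> (inv\<^bsub>G\<^esub> g) (\<phi> g x) = x"
      using g one by (simp flip: mult)
    then show "orbit G \<phi> x \<subseteq> orbit G \<phi> (\<phi> g x)"
      using orbit_sub[of "inv\<^bsub>G\<^esub> g" "\<phi> g x"] g by simp
  qed (rule orbit_sub[OF g])
  have self: "x \<in> orbit G \<phi> x" for x
    unfolding orbit_def mem_Collect_eq using one one_closed by metis
  have uniq: "r = r'" if "r \<in> R" "r' \<in> R" "r' \<in> orbit G \<phi> r" for r r'
    using that sep unfolding orbit_def mem_Collect_eq by metis
  have orbits: "orbits G E \<phi> = orbit G \<phi> ` R"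
  proof
    show "orbits G E \<phi> \<subseteq> orbit G \<phi> ` R"
      unfolding orbits_def using cover orbit_eq by fastforce
    show "orbit G \<phi> ` R \<subseteq> orbits G E \<phi>"
      unfolding orbits_def using \<open>R \<subseteq> E\<close> by blast
  qed
  have "inj_on (orbit G \<phi>) R"
    by (rule inj_onI) (metis self uniq)
  then have "card (orbits G E \<phi>) = card R"
    by (simp add: orbits card_image)
  moreover have "\<exists>!r. r \<in> R \<and> r \<in> orbit G \<phi> r0" if "r0 \<in> R" for r0
    using that self uniq by metis
  ultimately show ?thesis
    using \<open>R \<subseteq> E\<close> by (simp add: orbits_represented_by_def orbits)
qed

section \<open>Every stabilizing matrix belongs to one of the two families\<close>

lemma stab_mats_of_stabilize:
  fixes M :: "'a::field ^ 4 ^ 4"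
  assumes inv: "invertible M" and U: "U = matspace.span {s 0 1, s 0 2, s 2 3}"
    and "mact M ` U \<subseteq> U"
  shows "M \<in> stab_mats"
proof -
  have "s 0 1 \<in> U" "s 0 2 \<in> U" "s 2 3 \<in> U"
    unfolding U by (auto intro: matspace.span_base)
  then have "mact M (s 0 1) \<in> U" "mact M (s 0 2) \<in> U" "mact M (s 2 3) \<in> U"
    using assms(3) by auto
  moreover
  text \<open>\<open>P u v\<close> says that \<open>u \<and> v \<in> U\<close>.\<close>
  define P :: "'a ^ 4 \<Rightarrow> 'a ^ 4 \<Rightarrow> bool" where
    "P u v \<longleftrightarrow> u $ 0 * v $ 3 = u $ 3 * v $ 0 \<and> u $ 1 * v $ 2 = u $ 2 * v $ 1 \<and>
      u $ 1 * v $ 3 = u $ 3 * v $ 1" for u v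
  \<comment> \<open>For columns u and v of \<open>M\<close> with indices j and k,
    \<open>mact M (s j k)\<close> is u v' - v u'. \<open>P u v\<close> says that its entries at
    (0,3), (1,2) and (1,3) vanish.\<close>
  ultimately have P: "P (column 0 M) (column 1 M)" "P (column 0 M) (column 2 M)"
      "P (column 2 M) (column 3 M)"
    unfolding U mem_span_iff P_def mact_nth sum_four
    by (simp_all add: s_nth column_def algebra_simps)
  have P_sym: "P v u" if "P u v" for u v
    using that unfolding P_def by (auto simp: mult.commute)
  have indep: "x = 0 \<and> y = 0 \<and> z = 0"
    if "x *s column i M + y *s column j M + z *s column k M = 0"
      and ijk: "i \<noteq> j" "i \<noteq> k" "j \<noteq> k" for x y z i j k
  proof -
    let ?w = "x *s axis i 1 + y *s axis j 1 + z *s axis k 1 :: 'a ^ 4"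
    have basis: "M *v axis l 1 = column l M" for l
      by (simp add: vec_eq_iff matrix_vector_mult_def column_def axis_def if_distrib cong: if_cong)
    have "M *v ?w = 0"
      using that(1) by (simp add: matrix_vector_right_distrib vector_scalar_commute basis)
    then have w: "?w $ l = 0" for l
      using invertible_kernel[OF inv] by (metis zero_index)
    show ?thesis
      using w[of i] w[of j] w[of k] ijk by (simp add: axis_def)
  qed
  \<comment> \<open>If \<open>?u\<close> is outside the span of \<open>b\<^sub>0\<close> and
    \<open>b\<^sub>2\<close>, both partner columns lie in one plane spanned by \<open>?u\<close> and
    a basis vector \<open>b\<^sub>n\<close>. Three columns in a plane contradict
    independence.\<close>
  have plane: "column i M $ 1 = 0 \<and> column i M $ 3 = 0"
    if Pj: "P (column i M) (column j M)" and Pk: "P (column i M) (column k M)"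
      and ijk: "i \<noteq> j" "i \<noteq> k" "j \<noteq> k" for i j k
  proof (rule ccontr)
    let ?u = "column i M"
    assume nz: "\<not> (?u $ 1 = 0 \<and> ?u $ 3 = 0)"
    \<comment> \<open>\<open>m\<close> is a pivot coordinate of \<open>?u\<close>, and
      \<open>n\<close> is the one coordinate that is not controlled: \<open>m\<close> = 1,
      \<open>n\<close> = 0 if coordinate 3 of \<open>?u\<close> vanishes, and \<open>m\<close> = 3,
      \<open>n\<close> = 2 otherwise.\<close>
    obtain m n where m: "?u $ m \<noteq> 0"
      and par: "\<And>v l. P ?u v \<Longrightarrow> l \<noteq> n \<Longrightarrow> ?u $ m * v $ l = v $ m * ?u $ l"
    proof (cases "?u $ 3 = 0")
      case True
      have "\<forall>l. l \<noteq> 0 \<longrightarrow> ?u $ 1 * v $ l = v $ 1 * ?u $ l" if "P ?u v" for v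
        unfolding all_four using that by (simp add: P_def mult.commute)
      moreover have "?u $ 1 \<noteq> 0"
        using nz True by simp
      ultimately show ?thesis
        using that by blast
    next
      case False
      have "\<forall>l. l \<noteq> 2 \<longrightarrow> ?u $ 3 * v $ l = v $ 3 * ?u $ l" if "P ?u v" for v
        unfolding all_four using that by (simp add: P_def mult.commute)
      with False show ?thesis
        using that by blast
    qed
    \<comment> \<open>Elimination with pivot \<open>m\<close>, without division: for a partner
      column the result is a multiple of \<open>b\<^sub>n\<close>. Two such multiples are dependent,
      with coefficients \<open>q\<close> and \<open>-p\<close>.\<close>
    define w where "w j = ?u $ m *s column j M - column j M $ m *s ?u" for j
    have w0: "w l' $ l = 0" if "l \<noteq> n" "P ?u (column l' M)" for l l'
      using par[OF that(2,1)] by (simp add: w_def)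
    define p q where "p = w j $ n" and "q = w k $ n"
    have "q *s w j - p *s w k = 0"
      unfolding vec_eq_iff
    proof
      fix l
      show "(q *s w j - p *s w k) $ l = 0 $ l"
        using w0[of l j] w0[of l k] Pj Pk by (cases "l = n") (simp_all add: p_def q_def mult.commute)
    qed
    then have "(p * column k M $ m - q * column j M $ m) *s ?u
        + (q * ?u $ m) *s column j M + (- p * ?u $ m) *s column k M = 0"
      by (simp add: w_def vec_eq_iff algebra_simps)
    \<comment> \<open>The coefficient of column \<open>k\<close> is \<open>- p * ?u $ m\<close>, so
      \<open>p = 0\<close> and \<open>w j\<close> vanishes. This in turn is a relation between
      \<open>?u\<close> and column \<open>j\<close> in which column \<open>j\<close> has the nonzero
      coefficient \<open>?u $ m\<close>.\<close>
    from indep[OF this ijk] m have "w j $ n = 0"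
      by (simp add: p_def)
    then have "w j = 0"
      using w0[of _ j] Pj by (metis vec_eq_iff zero_index)
    then have "(- column j M $ m) *s ?u + ?u $ m *s column j M + 0 *s column k M = 0"
      by (simp add: w_def vec_eq_iff algebra_simps)
    from indep[OF this ijk] m show False
      by blast
  qed
  \<comment> \<open>Columns 0 and 2 are the ones with two partners: 1 and 2 for column 0, and 0 and
    3 for column 2.\<close>
  have z: "M $ 1 $ 0 = 0" "M $ 3 $ 0 = 0" "M $ 1 $ 2 = 0" "M $ 3 $ 2 = 0"
    using plane[of 0 1 2] plane[of 2 0 3] P P_sym by (simp_all add: column_def)
  have Q: "M $ 0 $ 0 * M $ 3 $ 1 = 0" "M $ 2 $ 0 * M $ 1 $ 1 = 0"
      "M $ 0 $ 2 * M $ 3 $ 3 = 0" "M $ 2 $ 2 * M $ 1 $ 3 = 0"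
    using P z by (auto simp: P_def column_def)
  \<comment> \<open>By \<open>z\<close> the matrix is block triangular in the basis order 0, 2, 1,
    3. Rows 1 and 3 are supported on columns 1 and 3, and columns 0 and 2 on rows 0 and 2, so both
    diagonal blocks are nonsingular.\<close>
  have det13: "M $ 1 $ 1 * M $ 3 $ 3 \<noteq> M $ 1 $ 3 * M $ 3 $ 1"
  proof
    assume *: "M $ 1 $ 1 * M $ 3 $ 3 = M $ 1 $ 3 * M $ 3 $ 1"
    have row: "x = 0 \<and> y = 0"
      if "M $ 1 $ 1 * x + M $ 3 $ 1 * y = 0" "M $ 1 $ 3 * x + M $ 3 $ 3 * y = 0" for x y
    proof -
      have "\<forall>i. M $ 0 $ i * 0 + M $ 1 $ i * x + M $ 2 $ i * 0 + M $ 3 $ i * y = 0"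
        using that z by (simp add: all_four)
      then show ?thesis
        using invertible_rows[OF inv, of 0 x 0 y] by blast
    qed
    \<comment> \<open>If the determinant vanishes, the cofactors are coefficients of relations
      between the two rows. Hence all four entries are zero, and then the coefficients 1, 1 give a
      relation as well. The other block is treated in the same way by columns.\<close>
    have "M $ 3 $ 1 = 0 \<and> M $ 1 $ 1 = 0"
      using row[of "M $ 3 $ 1" "- M $ 1 $ 1"] * by (simp add: mult.commute)
    moreover have "M $ 3 $ 3 = 0 \<and> M $ 1 $ 3 = 0"
      using row[of "M $ 3 $ 3" "- M $ 1 $ 3"] * by (simp add: mult.commute)
    ultimately show False
      using row[of 1 1] by simp
  qed
  have det02: "M $ 0 $ 0 * M $ 2 $ 2 \<noteq> M $ 0 $ 2 * M $ 2 $ 0"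
  proof
    assume *: "M $ 0 $ 0 * M $ 2 $ 2 = M $ 0 $ 2 * M $ 2 $ 0"
    have col: "x = 0 \<and> y = 0"
      if "M $ 0 $ 0 * x + M $ 0 $ 2 * y = 0" "M $ 2 $ 0 * x + M $ 2 $ 2 * y = 0" for x y
    proof -
      have "\<forall>i. M $ i $ 0 * x + M $ i $ 1 * 0 + M $ i $ 2 * y + M $ i $ 3 * 0 = 0"
        using that z by (simp add: all_four)
      then show ?thesis
        using invertible_columns[OF inv, of x 0 y 0] by blast
    qed
    have "M $ 0 $ 2 = 0 \<and> M $ 0 $ 0 = 0"
      using col[of "M $ 0 $ 2" "- M $ 0 $ 0"] * by (simp add: mult.commute)
    moreover have "M $ 2 $ 2 = 0 \<and> M $ 2 $ 0 = 0"
      using col[of "M $ 2 $ 2" "- M $ 2 $ 0"] * by (simp add: mult.commute)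
    ultimately show False
      using col[of 1 1] by simp
  qed
  show ?thesis
  \<comment> \<open>The products in \<open>Q\<close> link the blocks: a nonzero entry in one forces
    a zero in the other. With both determinants nonzero, \<open>M $ 0 $ 0\<close> decides whether
    both blocks are diagonal or both antidiagonal.\<close>
  proof (cases "M $ 0 $ 0 = 0")
    case False
    with Q det13 det02 have "M = tri_mat (M$0$0) (M$0$1) (M$0$3) (M$1$1) (M$2$1) (M$2$2) (M$2$3) (M$3$3)"
      using z by (auto simp: vec_eq_iff all_four tri_mat_def)
    moreover have "M$1$1 \<noteq> 0" "M$2$2 \<noteq> 0" "M$3$3 \<noteq> 0"
      using False Q det13 det02 by auto
    ultimately show ?thesis
      using False tri_mat_in by metis
  next
    case True
    with Q det13 det02 have "M = swap_mat (M$0$2) (M$0$3) (M$0$1) (M$1$3) (M$2$3) (M$2$0) (M$2$1) (M$3$1)"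
      using z by (auto simp: vec_eq_iff all_four swap_mat_def)
    moreover have "M$0$2 \<noteq> 0" "M$1$3 \<noteq> 0" "M$2$0 \<noteq> 0" "M$3$1 \<noteq> 0"
      using True Q det13 det02 by auto
    ultimately show ?thesis
      using swap_mat_in by metis
  qed
qed

lemma carrier_GL4_stab:
  assumes "U = matspace.span {s 0 1, s 0 2, s 2 3}"
  shows "carrier (GL4_stab U) = stab_mats"
proof -
  have "invertible M" if "M \<in> stab_mats" for M :: "'a::field ^ 4 ^ 4"
    using stab_mats_inverse[OF that] by (metis invertible_def)
  then have "M \<in> stab_mats \<longleftrightarrow> invertible M \<and> mact M ` U = U" for M
    using stab_mats_stabilize[OF _ assms] stab_mats_of_stabilize[OF _ assms] by blast
  then show ?thesis
    by (auto simp: GL4_stab_def stabilizer_def GL4_def mact_set_def)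
qed

section \<open>The orbits on vectors\<close>

lemma vec_eq_four: "(x = (y :: 'b ^ 4)) \<longleftrightarrow> x $ 0 = y $ 0 \<and> x $ 1 = y $ 1 \<and> x $ 2 = y $ 2 \<and> x $ 3 = y $ 3"
  by (simp add: vec_eq_iff all_four)

lemma tri_mat_vec:
  "tri_mat a b c d e f g h *v x =
    vec4 (a * x $ 0 + b * x $ 1 + c * x $ 3) (d * x $ 1) (e * x $ 1 + f * x $ 2 + g * x $ 3) (h * x $ 3)"
  by (simp add: vec_eq_four matrix_vector_mult_def sum_four tri_mat_def)

lemma swap_mat_vec:
  "swap_mat a b c d e f g h *v x =
    vec4 (c * x $ 1 + a * x $ 2 + b * x $ 3) (d * x $ 3) (f * x $ 0 + g * x $ 1 + e * x $ 3) (h * x $ 1)"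
  by (simp add: vec_eq_four matrix_vector_mult_def sum_four swap_mat_def)

lemma vec_orbit_cover:
  fixes x :: "'a::field ^ 4"
  shows "\<exists>r \<in> {0, bvec 0, bvec 0 + bvec 2, bvec 0 + bvec 2 + bvec 3, bvec 1 + bvec 3}.
    \<exists>g \<in> stab_mats. g *v r = x"
proof -
  let ?R = "{0, bvec 0, bvec 0 + bvec 2, bvec 0 + bvec 2 + bvec 3, bvec 1 + bvec 3} :: ('a ^ 4) set"
  have goal: ?thesis if "r \<in> ?R" "g \<in> stab_mats" "g *v r = x" for r g
    using that by blast
  note simps = tri_mat_in swap_mat_in tri_mat_vec swap_mat_vec vec_eq_four bvec_nth
  \<comment> \<open>The cases record which of coordinates 1 and 3 are nonzero and, if neither is,
    which of 0 and 2 are. Cases 3 and 6 mirror 2 and 5 and are reached by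
    \<open>swap_mat\<close>.\<close>
  consider "x = 0"
    | "x $ 1 = 0" "x $ 3 = 0" "x $ 0 \<noteq> 0" "x $ 2 = 0"
    | "x $ 1 = 0" "x $ 3 = 0" "x $ 0 = 0" "x $ 2 \<noteq> 0"
    | "x $ 1 = 0" "x $ 3 = 0" "x $ 0 \<noteq> 0" "x $ 2 \<noteq> 0"
    | "x $ 1 = 0" "x $ 3 \<noteq> 0" | "x $ 1 \<noteq> 0" "x $ 3 = 0" | "x $ 1 \<noteq> 0" "x $ 3 \<noteq> 0"
    by (auto simp: vec_eq_four)
  then show ?thesis
  proof cases
    case 1
    then show ?thesis
      by (intro goal[of 0 "tri_mat 1 0 0 1 0 1 0 1"]) (simp_all add: simps)
  next
    case 2
    then show ?thesis
      by (intro goal[of "bvec 0" "tri_mat (x $ 0) 0 0 1 0 1 0 1"]) (simp_all add: simps)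
  next
    case 3
    then show ?thesis
      by (intro goal[of "bvec 0" "swap_mat 1 0 0 1 0 (x $ 2) 0 1"]) (simp_all add: simps)
  next
    case 4
    then show ?thesis
      by (intro goal[of "bvec 0 + bvec 2" "tri_mat (x $ 0) 0 0 1 0 (x $ 2) 0 1"])
        (simp_all add: simps)
  next
    case 5
    then show ?thesis
      \<comment> \<open>\<open>bvec 0\<close> and \<open>bvec 2\<close> already contribute 1 to
        coordinates 0 and 2, so the image of \<open>bvec 3\<close> supplies the rest; hence the
        subtraction of 1.\<close>
      by (intro goal[of "bvec 0 + bvec 2 + bvec 3" "tri_mat 1 0 (x $ 0 - 1) 1 0 1 (x $ 2 - 1) (x $ 3)"])
        (simp_all add: simps)
  next
    case 6
    then show ?thesis
      by (intro goal[of "bvec 0 + bvec 2 + bvec 3" "swap_mat 1 (x $ 0 - 1) 0 (x $ 1) (x $ 2 - 1) 1 0 1"])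
        (simp_all add: simps)
  next
    case 7
    then show ?thesis
      by (intro goal[of "bvec 1 + bvec 3" "tri_mat 1 (x $ 0) 0 (x $ 1) (x $ 2) 1 0 (x $ 3)"])
        (simp_all add: simps)
  qed
qed

text \<open>Coordinates 1 and 3 are scaled by nonzero factors and possibly exchanged, so the number
  of nonzero ones is invariant. If both vanish, the same holds for coordinates 0 and 2. These
  numbers differ for the five representatives.\<close>

lemma vec_orbit_separate:
  fixes r :: "'a::field ^ 4"
  assumes "g \<in> stab_mats"
    and "r \<in> {0, bvec 0, bvec 0 + bvec 2, bvec 0 + bvec 2 + bvec 3, bvec 1 + bvec 3}"
    and "g *v r \<in> {0, bvec 0, bvec 0 + bvec 2, bvec 0 + bvec 2 + bvec 3, bvec 1 + bvec 3}"
  shows "g *v r = r"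
proof -
  have mem: "v \<in> {0, bvec 0, bvec 0 + bvec 2, bvec 0 + bvec 2 + bvec 3, bvec 1 + bvec 3} \<longleftrightarrow>
      v $ 0 = 0 \<and> v $ 1 = 0 \<and> v $ 2 = 0 \<and> v $ 3 = 0 \<or>
      v $ 0 = 1 \<and> v $ 1 = 0 \<and> v $ 2 = 0 \<and> v $ 3 = 0 \<or>
      v $ 0 = 1 \<and> v $ 1 = 0 \<and> v $ 2 = 1 \<and> v $ 3 = 0 \<or>
      v $ 0 = 1 \<and> v $ 1 = 0 \<and> v $ 2 = 1 \<and> v $ 3 = 1 \<or>
      v $ 0 = 0 \<and> v $ 1 = 1 \<and> v $ 2 = 0 \<and> v $ 3 = 1" for v :: "'a ^ 4"
    by (simp add: vec_eq_four bvec_nth)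
  note r = assms(2,3)[unfolded mem]
  show ?thesis
    using assms(1)
  proof (cases rule: stab_mats_cases)
    case (tri a b c d e f g h)
    then show ?thesis
      using r unfolding vec_eq_four[of _ r] tri(1) tri_mat_vec vec4_nth
      by (elim disjE conjE; simp)
  next
    case (swap a b c d e f g h)
    then show ?thesis
      using r unfolding vec_eq_four[of _ r] swap(1) swap_mat_vec vec4_nth
      by (elim disjE conjE; simp)
  qed
qed

section \<open>The orbits on the quotient of \<open>\<Lambda>\<close> by \<open>U\<close>\<close>

lemma coset_eq_iff:
  assumes U: "U = matspace.span {s 0 1, s 0 2, s 2 3}" and "X \<in> \<Lambda>" "Y \<in> \<Lambda>"
  shows "X +o U = Y +o U \<longleftrightarrow>
    X $ 0 $ 3 = Y $ 0 $ 3 \<and> X $ 1 $ 2 = Y $ 1 $ 2 \<and> X $ 1 $ 3 = Y $ 1 $ 3"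
proof -
  have mem: "Z \<in> W +o U \<longleftrightarrow> Z - W \<in> U" for W Z
    by (auto simp: elt_set_plus_def) (metis add.commute diff_add_cancel)
  have "X +o U = Y +o U \<longleftrightarrow> X - Y \<in> U"
  proof
    assume "X +o U = Y +o U"
    moreover have "X \<in> X +o U"
      unfolding mem by (simp add: U matspace.span_zero)
    ultimately show "X - Y \<in> U"
      using mem by blast
  next
    assume *: "X - Y \<in> U"
    have "Z - X \<in> U \<longleftrightarrow> Z - Y \<in> U" for Z
      using matspace.span_add[OF *[unfolded U], of "Z - X"]
        matspace.span_diff[OF _ *[unfolded U], of "Z - Y"] by (auto simp: U)
    then show "X +o U = Y +o U"
      by (auto simp: mem)
  qed
  also have "\<dots> \<longleftrightarrow> X $ 0 $ 3 = Y $ 0 $ 3 \<and> X $ 1 $ 2 = Y $ 1 $ 2 \<and> X $ 1 $ 3 = Y $ 1 $ 3"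
    using Lam_diff[OF assms(2,3)] by (simp add: U mem_span_iff)
  finally show ?thesis .
qed

lemma mact_set_coset:
  assumes U: "U = matspace.span {s 0 1, s 0 2, s 2 3}" and "M \<in> stab_mats"
  shows "mact_set M (X +o U) = mact M X +o U"
proof -
  have add: "mact M (X + Y) = mact M X + mact M Y" for Y
    using mact_diff[of M "X + Y" Y] by simp
  have coset: "W +o U = (+) W ` U" for W
    by (auto simp: elt_set_plus_def)
  have "mact_set M (X +o U) = (+) (mact M X) ` mact M ` U"
    by (simp add: mact_set_def coset image_image add)
  then show ?thesis
    using stab_mats_stabilize[OF assms(2) U] by (simp add: coset)
qed

lemma representatives_in_Lam: "s 0 3 \<in> \<Lambda>" "s 1 3 \<in> \<Lambda>" "s 0 3 + s 1 2 \<in> \<Lambda>" "0 \<in> \<Lambda>"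
  by (simp_all add: mem_Lam_iff s_nth)

lemma quot_orbit_cover:
  assumes U: "U = matspace.span {s 0 1, s 0 2, s 2 3}" and "V \<in> Lam_quot U"
  shows "\<exists>X \<in> {0, s 0 3, s 1 3, s 0 3 + s 1 2}. \<exists>g \<in> stab_mats. mact_set g (X +o U) = V"
proof -
  let ?R = "{0, s 0 3, s 1 3, s 0 3 + s 1 2} :: ('a ^ 4 ^ 4) set"
  obtain Y where Y: "Y \<in> \<Lambda>" "V = Y +o U"
    using assms(2) by (auto simp: Lam_quot_def)
  have goal: ?thesis if "X \<in> ?R" "g \<in> stab_mats"
    "mact g X $ 0 $ 3 = Y $ 0 $ 3" "mact g X $ 1 $ 2 = Y $ 1 $ 2" "mact g X $ 1 $ 3 = Y $ 1 $ 3"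
    for X g
  proof -
    have "X \<in> \<Lambda>"
      using that(1) representatives_in_Lam by auto
    then have "mact_set g (X +o U) = V"
      unfolding mact_set_coset[OF U that(2)] Y(2)
      using coset_eq_iff[OF U mact_Lam Y(1)] that(3-) by blast
    with that(1,2) show ?thesis by blast
  qed
  note simps = tri_mat_in swap_mat_in mact_tri_mat mact_swap_mat representatives_in_Lam s_nth
  consider "Y $ 1 $ 3 \<noteq> 0"
    | "Y $ 1 $ 3 = 0" "Y $ 0 $ 3 = 0" "Y $ 1 $ 2 = 0"
    | "Y $ 1 $ 3 = 0" "Y $ 0 $ 3 \<noteq> 0" "Y $ 1 $ 2 = 0"
    | "Y $ 1 $ 3 = 0" "Y $ 0 $ 3 = 0" "Y $ 1 $ 2 \<noteq> 0"
    | "Y $ 1 $ 3 = 0" "Y $ 0 $ 3 \<noteq> 0" "Y $ 1 $ 2 \<noteq> 0"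
    by auto
  then show ?thesis
  proof cases
    case 1
    then show ?thesis
      \<comment> \<open>The image of \<open>s 1 3\<close> has entries \<open>b * h\<close>,
        \<open>d * g\<close> and \<open>d * h\<close> at (0,3), (1,2) and (1,3); with
        \<open>d\<close> = 1 these are solved for \<open>h\<close>, \<open>g\<close> and
        \<open>b\<close>.\<close>
      by (intro goal[of "s 1 3" "tri_mat 1 (Y $ 0 $ 3 / Y $ 1 $ 3) 0 1 0 1 (Y $ 1 $ 2) (Y $ 1 $ 3)"])
        (simp_all add: simps)
  next
    case 2
    then show ?thesis
      by (intro goal[of 0 "tri_mat 1 0 0 1 0 1 0 1"]) (simp_all add: simps)
  next
    case 3
    then show ?thesis
      by (intro goal[of "s 0 3" "tri_mat (Y $ 0 $ 3) 0 0 1 0 1 0 1"]) (simp_all add: simps)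
  next
    case 4
    then show ?thesis
      \<comment> \<open>The exchange carries \<open>s 0 3\<close> to a multiple of
        \<open>s 2 1\<close>, that is of \<open>- s 1 2\<close>; hence the sign.\<close>
      by (intro goal[of "s 0 3" "swap_mat 1 0 0 1 0 (- Y $ 1 $ 2) 0 1"]) (simp_all add: simps)
  next
    case 5
    then show ?thesis
      by (intro goal[of "s 0 3 + s 1 2" "tri_mat (Y $ 0 $ 3) 0 0 1 0 (Y $ 1 $ 2) 0 1"])
        (simp_all add: simps)
  qed
qed

text \<open>Whether the entry at (1,3) vanishes is invariant. If it does, the entries at (0,3) and
  (1,2) are scaled by nonzero factors and possibly exchanged, so the number of nonzero ones is
  invariant: 0, 1 or 2 for the representatives other than \<open>s 1 3\<close>.\<close>

lemma quot_orbit_separate: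
  assumes U: "U = matspace.span {s 0 1, s 0 2, s 2 3}" and g: "g \<in> stab_mats"
    and X: "X \<in> {0, s 0 3, s 1 3, s 0 3 + s 1 2}" and Y: "Y \<in> {0, s 0 3, s 1 3, s 0 3 + s 1 2}"
    and eq: "mact_set g (X +o U) = Y +o U"
  shows "X = Y"
proof -
  have L: "X \<in> \<Lambda>" "Y \<in> \<Lambda>"
    using X Y representatives_in_Lam by auto
  have *: "mact g X $ 0 $ 3 = Y $ 0 $ 3 \<and> mact g X $ 1 $ 2 = Y $ 1 $ 2 \<and> mact g X $ 1 $ 3 = Y $ 1 $ 3"
    using eq coset_eq_iff[OF U mact_Lam[OF L(1)] L(2)] by (simp add: mact_set_coset[OF U g])
  from g show ?thesis
  proof (cases rule: stab_mats_cases)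
    case tri
    with X Y * show ?thesis
      unfolding insert_iff empty_iff tri(1) mact_tri_mat[OF L(1)]
      by (elim disjE FalseE; simp add: s_nth)
  next
    case swap
    with X Y * show ?thesis
      unfolding insert_iff empty_iff swap(1) mact_swap_mat[OF L(1)]
      by (elim disjE FalseE; simp add: s_nth)
  qed
qed

theorem proposition4p8:
  fixes U :: "('a::field ^ 4 ^ 4) set"
  assumes U_def: "U = matspace.span {s 0 1, s 0 2, s 2 3}"
  shows
    "carrier (GL4_stab U) =
      {mat4 (vec4 a b 0 c)
            (vec4 0 d 0 0)
            (vec4 0 e f g)
            (vec4 0 0 0 h) | a b c d e f g h.
         a \<noteq> 0 \<and> d \<noteq> 0 \<and> f \<noteq> 0 \<and> h \<noteq> 0}
      \<union>
      {mat4 (vec4 0 c a b)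
            (vec4 0 0 0 d)
            (vec4 f g 0 e)
            (vec4 0 h 0 0) | a b c d e f g h.
         a \<noteq> 0 \<and> d \<noteq> 0 \<and> f \<noteq> 0 \<and> h \<noteq> 0}
     \<and> card (orbits (GL4_stab U) (UNIV :: ('a ^ 4) set) (*v)) = 5
     \<and> orbits_represented_by (GL4_stab U) (UNIV :: ('a ^ 4) set) (*v)
         {0, bvec 0, bvec 0 + bvec 2, bvec 0 + bvec 2 + bvec 3, bvec 1 + bvec 3}
     \<and> card (orbits (GL4_stab U) (Lam_quot U) mact_set) = 4
     \<and> orbits_represented_by (GL4_stab U) (Lam_quot U) mact_set
         {U, s 0 3 +o U, s 1 3 +o U, (s 0 3 + s 1 2) +o U}"
proof -
  note carrier = carrier_GL4_stab[OF U_def]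
  have shapes: "carrier (GL4_stab U) =
      {mat4 (vec4 a b 0 c) (vec4 0 d 0 0) (vec4 0 e f g) (vec4 0 0 0 h) | a b c d e f g h.
         a \<noteq> 0 \<and> d \<noteq> 0 \<and> f \<noteq> 0 \<and> h \<noteq> 0} \<union>
      {mat4 (vec4 0 c a b) (vec4 0 0 0 d) (vec4 f g 0 e) (vec4 0 h 0 0) | a b c d e f g h.
         a \<noteq> 0 \<and> d \<noteq> 0 \<and> f \<noteq> 0 \<and> h \<noteq> 0}"
    unfolding carrier stab_mats_def tri_mat_def swap_mat_def ..
  have one: "\<one>\<^bsub>GL4_stab U\<^esub> = mat 1" and mult: "\<And>g h. g \<otimes>\<^bsub>GL4_stab U\<^esub> h = g ** h"
    by (simp_all add: GL4_stab_def GL4_def)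
  let ?R = "{0, bvec 0, bvec 0 + bvec 2, bvec 0 + bvec 2 + bvec 3, bvec 1 + bvec 3} :: ('a ^ 4) set"
  have vec: "card (orbits (GL4_stab U) (UNIV :: ('a ^ 4) set) (*v)) = card ?R \<and>
      orbits_represented_by (GL4_stab U) (UNIV :: ('a ^ 4) set) (*v) ?R"
  proof (intro orbits_represented_by_transversal group_GL4_stab)
    show "\<exists>r\<in>?R. \<exists>g\<in>carrier (GL4_stab U). g *v r = x" for x
      using vec_orbit_cover unfolding carrier .
    show "g *v r = r" if "r \<in> ?R" "g \<in> carrier (GL4_stab U)" "g *v r \<in> ?R" for r g
      using that vec_orbit_separate unfolding carrier by blast
  qed (simp_all add: one mult matrix_vector_mul_assoc)
  have card_R: "card ?R = 5"
    by (simp add: vec_eq_four bvec_nth)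
  let ?X = "{0, s 0 3, s 1 3, s 0 3 + s 1 2} :: ('a ^ 4 ^ 4) set"
  let ?Q = "(\<lambda>X. X +o U) ` ?X"
  have Q: "card (orbits (GL4_stab U) (Lam_quot U) mact_set) = card ?Q \<and>
      orbits_represented_by (GL4_stab U) (Lam_quot U) mact_set ?Q"
  proof (intro orbits_represented_by_transversal group_GL4_stab)
    show "?Q \<subseteq> Lam_quot U"
      using representatives_in_Lam unfolding Lam_quot_def by blast
    show "\<exists>r\<in>?Q. \<exists>g\<in>carrier (GL4_stab U). mact_set g r = V" if "V \<in> Lam_quot U" for V
      using quot_orbit_cover[OF U_def that] unfolding carrier by blast
    show "mact_set g r = r" if "r \<in> ?Q" "g \<in> carrier (GL4_stab U)" "mact_set g r \<in> ?Q" for r g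
    proof -
      obtain X Y where "X \<in> ?X" "r = X +o U" "Y \<in> ?X" "mact_set g r = Y +o U"
        using \<open>r \<in> ?Q\<close> \<open>mact_set g r \<in> ?Q\<close> by (elim imageE)
      moreover from this have "X = Y"
        using quot_orbit_separate[OF U_def, of g X Y] that(2) unfolding carrier by simp
      ultimately show ?thesis
        by simp
    qed
  qed (auto simp: one mult mact_set_def mact_mult image_image)
  \<comment> \<open>Separation applied to the identity matrix shows that the four representatives
    lie in distinct cosets, as the count of orbits requires.\<close>
  have "(mat 1 :: 'a ^ 4 ^ 4) \<in> stab_mats"
    using monoid.one_closed[OF group.is_monoid[OF group_GL4_stab[of U]]] unfolding carrier one .
  moreover have "mact_set (mat 1) V = V" for V :: "('a ^ 4 ^ 4) set"
    by (simp add: mact_set_def)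
  ultimately have "inj_on (\<lambda>X. X +o U) ?X"
    by (intro inj_onI quot_orbit_separate[OF U_def]) simp_all
  then have "card ?Q = card ?X"
    by (rule card_image)
  also have "\<dots> = 4"
    by (simp add: vec_eq_four s_nth)
  finally have card_Q: "card ?Q = 4" .
  have Q_eq: "?Q = {U, s 0 3 +o U, s 1 3 +o U, (s 0 3 + s 1 2) +o U}"
    by (simp add: elt_set_plus_def)
  show ?thesis
    using shapes vec Q unfolding card_R Q_eq card_Q[unfolded Q_eq]
    by (elim conjE) (intro conjI; assumption)
qed

end
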